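(* Let $\alpha$ be a complex number, $r>0$ an integer and $n\ge 0$ an integer. Then $$\sum_{j=0}^{r-1}(j\mid\alpha)_{n}=\sum_{k=0}^{n}S_{2}(n,k,r\mid\alpha)\frac{(-1)^{k}\langle r\rangle_{k+1}}{k+1}.$$
   Context: The generalized factorial with increment $\alpha$ is $(z\mid\alpha)_0=1$, $(z\mid\alpha)_n=z(z-\alpha)\cdots(z-n\alpha+\alpha)$ for $n\ge1$. The rising factorial is $\langle y\rangle_{0}=1$, $\langle y\rangle_{k}=y(y+1)\cdots(y+k-1)$. Howard's degenerate weighted Stirling numbers of the second kind $S_2(n,k,r\mid\alpha)$ are defined by the formal power series identity $$\left((1+\alpha t)^{1/\alpha}-1\right)^{k}(1+\alpha t)^{r/\alpha}=k!\sum_{n=0}^{\infty}S_{2}(n,k,r\mid\alpha)\frac{t^{n}}{n!},$$ where $(1+\alpha t)^{c/\alpha}=\exp\left(\frac{c}{\alpha}\log(1+\alpha t)\right)$, interpreted as $e^{ct}$ when $\alpha=0$. *)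

theory Defs
  imports Complex_Main "HOL-Computational_Algebra.Formal_Power_Series"
begin

definition gen_fact :: "complex \<Rightarrow> complex \<Rightarrow> nat \<Rightarrow> complex" where
  "gen_fact z \<alpha> n = (\<Prod>i<n. z - of_nat i * \<alpha>)"

text \<open>The power series \<open>(1 + \<alpha> t) ^ (c / \<alpha>) = exp ((c / \<alpha>) log (1 + \<alpha> t))\<close> in \<open>t\<close>, read as
  \<open>exp (c t)\<close> for \<open>\<alpha> = 0\<close>. Here \<^term>\<open>fps_ln 1\<close> is the series of \<open>log (1 + t)\<close>, and
  \<^term>\<open>fps_exp a\<close> is that of \<open>exp (a t)\<close>.\<close>

definition degenerate_exp :: "complex \<Rightarrow> complex \<Rightarrow> complex fps" where
  "degenerate_exp \<alpha> c =
     (if \<alpha> = 0 then fps_exp c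
      else fps_exp (c / \<alpha>) oo (fps_ln 1 oo (fps_const \<alpha> * fps_X)))"

text \<open>The numbers are read off as the coefficients of their generating function; the lemma
  below is the generating function identity itself.\<close>

definition howard_S2 :: "nat \<Rightarrow> nat \<Rightarrow> complex \<Rightarrow> complex \<Rightarrow> complex" where
  "howard_S2 n k r \<alpha> =
     fact n / fact k * fps_nth ((degenerate_exp \<alpha> 1 - 1) ^ k * degenerate_exp \<alpha> r) n"

lemma howard_S2_gen_fun:
  "(degenerate_exp \<alpha> 1 - 1) ^ k * degenerate_exp \<alpha> r =
     fps_const (fact k) * Abs_fps (\<lambda>n. howard_S2 n k r \<alpha> / fact n)"
  by (rule fps_ext) (simp add: howard_S2_def)

end

theory Submission imports Defs begin

text \<open>Let \<open>F\<close> be the power series with coefficients \<open>(-1) ^ k \<langle>r\<rangle>\<^sub>k\<^sub>+\<^sub>1 / (k+1)!\<close>,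
  that is, \<open>(1 - (1+u) ^ (-r)) / u\<close>. Then \<open>F(u) (1+u) ^ r\<close> is the geometric sum
  \<open>\<Sum>j<r. (1+u) ^ j\<close>. Substituting \<open>1 + u = (1 + \<alpha> t) ^ (1/\<alpha>)\<close> and comparing coefficients of
  \<open>t ^ n\<close> gives the claim, because the coefficients of \<open>(1 + \<alpha> t) ^ (j/\<alpha>)\<close> are \<open>(j|\<alpha>)\<^sub>n / n!\<close>.\<close>

text \<open>Both series have constant term 1 and solve \<open>f' = a f / (1 + X)\<close>, whose
  solutions are determined by their constant term.\<close>

lemma fps_exp_compose_fps_ln:
  "fps_exp a oo fps_ln 1 = fps_binomial (a :: 'a :: field_char_0)"
proof -
  let ?f = "fps_exp a oo fps_ln 1"
  have "fps_deriv ?f = fps_const a * ?f * inverse (1 + fps_X)"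
    by (simp add: fps_compose_deriv fps_ln_deriv fps_compose_mult_distrib)
  then have "fps_deriv ?f = fps_const a * ?f / (1 + fps_X)"
    by (simp add: fps_divide_unit)
  then have "?f = fps_const (fps_nth ?f 0) * fps_binomial a"
    by (simp only: fps_binomial_ODE_unique)
  then show ?thesis by simp
qed

lemma degenerate_exp_eq_binomial:
  "\<alpha> \<noteq> 0 \<Longrightarrow> degenerate_exp \<alpha> c = fps_binomial (c / \<alpha>) oo (fps_const \<alpha> * fps_X)"
  by (simp add: degenerate_exp_def fps_compose_assoc flip: fps_exp_compose_fps_ln)

lemma degenerate_exp_nth: "fps_nth (degenerate_exp \<alpha> c) n = gen_fact c \<alpha> n / fact n"
proof (cases "\<alpha> = 0")
  case True
  then show ?thesis by (simp add: degenerate_exp_def gen_fact_def)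
next
  case False
  \<comment> \<open>The factors \<alpha> pulled out here match the powers \<alpha>^n that
    substituting \<alpha> t produces in the binomial series.\<close>
  have "gen_fact c \<alpha> n = (\<Prod>i<n. \<alpha> * (c / \<alpha> - of_nat i))"
    using False by (simp add: gen_fact_def algebra_simps)
  then have "gen_fact c \<alpha> n = \<alpha> ^ n * (\<Prod>i<n. c / \<alpha> - of_nat i)"
    by (simp add: prod.distrib)
  with False show ?thesis
    by (simp add: degenerate_exp_eq_binomial gbinomial_prod_rev atLeast0LessThan)
qed

lemma degenerate_exp_of_nat: "degenerate_exp \<alpha> (of_nat j) = degenerate_exp \<alpha> 1 ^ j"
proof (cases "\<alpha> = 0")
  case True
  then show ?thesis by (simp add: degenerate_exp_def fps_exp_power_mult)
next
  case False
  then show ?thesis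
    by (simp add: degenerate_exp_eq_binomial fps_binomial_power fps_compose_power)
qed

lemma rising_factorial_series_times_power:
  fixes r :: nat
  defines "F \<equiv> Abs_fps (\<lambda>k. (-1) ^ k * pochhammer (of_nat r) (k + 1) / fact (k + 1))"
  shows "F * (1 + fps_X) ^ r = (\<Sum>j<r. (1 + fps_X :: 'a :: field_char_0 fps) ^ j)"
proof -
  \<comment> \<open>The factor X avoids dividing by X; it is cancelled at the end. The 1 removes the
    constant term of \<open>(1 + X)^(-r)\<close>, and its later coefficients change sign.\<close>
  have "fps_X * F = 1 - fps_binomial (- of_nat r)"
    by (rule fps_ext, rename_tac k, case_tac k) (simp_all add: F_def gbinomial_pochhammer)
  then have "fps_X * (F * (1 + fps_X) ^ r)
      = (1 - fps_binomial (- of_nat r)) * fps_binomial (of_nat r)"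
    by (simp add: fps_binomial_of_nat flip: mult.assoc)
  also have "\<dots> = (1 + fps_X) ^ r - 1"
    by (simp add: left_diff_distrib fps_binomial_of_nat flip: fps_binomial_add_mult)
       (simp flip: fps_binomial_add_mult fps_binomial_of_nat)
  also have "\<dots> = fps_X * (\<Sum>j<r. (1 + fps_X) ^ j)"
    by (simp add: power_diff_1_eq)
  finally show ?thesis by simp
qed

text \<open>Since \<open>u ^ k\<close> has no terms below degree k, every inner sum may run up to
  the common bound n, so the two sums can be swapped.\<close>

lemma fps_compose_mult_nth:
  fixes F G u :: "'a :: comm_ring_1 fps"
  assumes "fps_nth u 0 = 0"
  shows "fps_nth ((F oo u) * G) n = (\<Sum>k=0..n. fps_nth F k * fps_nth (u ^ k * G) n)"
proof -
  have "fps_nth (F oo u) i = (\<Sum>k=0..n. fps_nth F k * fps_nth (u ^ k) i)" if "i \<le> n" for i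
    unfolding fps_compose_nth using that assms
    by (intro sum.mono_neutral_left) (auto simp: startsby_zero_power_prefix)
  then have "fps_nth ((F oo u) * G) n = (\<Sum>i=0..n. \<Sum>k=0..n. fps_nth F k * (fps_nth (u ^ k) i * fps_nth G (n - i)))"
    by (simp add: fps_mult_nth sum_distrib_right mult.assoc)
  also have "\<dots> = (\<Sum>k=0..n. fps_nth F k * fps_nth (u ^ k * G) n)"
    by (subst sum.swap) (simp add: fps_mult_nth sum_distrib_left)
  finally show ?thesis .
qed

theorem corollary5:
  fixes \<alpha> :: complex and r n :: nat
  assumes "r > 0"
  shows "(\<Sum>j=0..r-1. gen_fact (of_nat j) \<alpha> n) =
         (\<Sum>k=0..n. howard_S2 n k (of_nat r) \<alpha> *
            ((-1) ^ k * pochhammer (of_nat r) (k + 1) / of_nat (k + 1)))"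
proof -
  define E where "E = degenerate_exp \<alpha> 1"
  define F where "F = Abs_fps (\<lambda>k. (-1) ^ k * pochhammer (of_nat r) (k + 1) / fact (k + 1) :: complex)"
  have u0: "fps_nth (E - 1) 0 = 0"
    by (simp add: E_def degenerate_exp_nth gen_fact_def)
  have X: "(1 + fps_X) oo (E - 1) = E"
    using u0 by (simp add: fps_compose_add_distrib)
  have "(F oo (E - 1)) * E ^ r = (F * (1 + fps_X) ^ r) oo (E - 1)"
    using u0 X by (simp add: fps_compose_mult_distrib fps_compose_power[symmetric])
  also have "\<dots> = (\<Sum>j<r. E ^ j)"
    using u0 X unfolding F_def rising_factorial_series_times_power
    by (simp add: fps_compose_sum_distrib fps_compose_power[symmetric])
  finally have key: "(F oo (E - 1)) * E ^ r = (\<Sum>j<r. E ^ j)" .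
  \<comment> \<open>For r = 0 truncated subtraction would leave the index 0 on the left.\<close>
  have "{0..r-1} = {..<r}" using assms by auto
  then have "(\<Sum>j=0..r-1. gen_fact (of_nat j) \<alpha> n) = fact n * fps_nth (\<Sum>j<r. E ^ j) n"
    by (simp add: fps_sum_nth E_def degenerate_exp_nth sum_distrib_left
        flip: degenerate_exp_of_nat)
  also have "\<dots> = fact n * (\<Sum>k=0..n. fps_nth F k * fps_nth ((E - 1) ^ k * E ^ r) n)"
    by (simp only: fps_compose_mult_nth[OF u0] flip: key)
  \<comment> \<open>The 1/k! inside \<open>howard_S2\<close> and the 1/(k+1) combine to the 1/(k+1)!
    in \<open>F\<close>.\<close>
  also have "\<dots> = (\<Sum>k=0..n. howard_S2 n k (of_nat r) \<alpha> *
            ((-1) ^ k * pochhammer (of_nat r) (k + 1) / of_nat (k + 1)))"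
    by (simp add: sum_distrib_left howard_S2_def F_def E_def degenerate_exp_of_nat mult_ac)
  finally show ?thesis .
qed

end
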